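(* Suppose that $\mathcal{S}\subseteq\mathcal{R}$ is a free-graded Frobenius extension of degree $d\in G$ and let $D$ be the multiset of degrees of the elements of a homogeneous basis of $\mathcal{R}$ over $\mathcal{S}$. Then $D=D^{-1}d^{-1}$ as multisets, where $D^{-1}d^{-1}=\{g^{-1}d^{-1}\mid g\in D\}$.
   Context: Conventions: $k$ is a field; algebras are associative unital $k$-algebras with the invariant basis number property; "module" means left module. $(G,\leq)$ is a totally ordered, finitely generated abelian group, written multiplicatively, with identity $1_G$. A $G$-grading is a decomposition $V=\bigoplus_gV^g$ (with $R^gR^h\subseteq R^{gh}$ for algebras). Gradings of algebras are assumed $k$-finite ($\dim V^g<\infty$), non-negative ($V^g=0$ for $g<1_G$) and proper ($V\ne\bigoplus_{h\le g}V^h$ for all $g$). A graded module is free-graded if it has a homogeneous basis. Let $\mathcal{R}$ be a graded algebra and $\mathcal{S}$ a graded subalgebra. $\operatorname{Hom}_{\mathcal{S}}(\mathcal{R},\mathcal{S})$ (left $\mathcal{S}$-module maps) is an $\mathcal{R}$-$\mathcal{S}$-bimodule by $(f.s)(r)=f(r)s$, $(q.f)(r)=f(rq)$. $\mathcal{S}\subseteq\mathcal{R}$ is a free Frobenius extension if $\mathcal{R}$ is a finite free left $\mathcal{S}$-module and $\mathcal{R}\cong\operatorname{Hom}_{\mathcal{S}}(\mathcal{R},\mathcal{S})$ as $\mathcal{R}$-$\mathcal{S}$-bimodules. A Frobenius form is a left $\mathcal{S}$-module map $\Phi:\mathcal{R}\to\mathcal{S}$ such that (F1) $\operatorname{Ker}\Phi$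 contains no non-zero left or right ideals of $\mathcal{R}$, and (F2) $r\mapsto(q\mapsto\Phi(qr))$ is a surjection $\mathcal{R}\to\operatorname{Hom}_{\mathcal{S}}(\mathcal{R},\mathcal{S})$. $\mathcal{S}\subseteq\mathcal{R}$ is a free-graded Frobenius extension if it is a free Frobenius extension with a homogeneous Frobenius form $\Phi$, and $\mathcal{R}$ is a free-graded $\mathcal{S}$-module. The degree of the extension is the degree of $\Phi$, i.e. the $d\in G$ with $\Phi(\mathcal{R}^g)\subseteq\mathcal{S}^{gd}$ for all $g$. *)

theory Defs
  imports
    Complex_Main
    "HOL-Library.Multiset"
    "HOL-Computational_Algebra.Group_Closure"
begin

text \<open>
  The grading group is a type of class \<^class>\<open>linordered_ab_group_add\<close>, so it is written
  additively: \<open>1\<^sub>G\<close> is \<open>0\<close>, \<open>g d\<close> is \<open>g + d\<close> and \<open>g\<^sup>-\<^sup>1 d\<^sup>-\<^sup>1\<close> is \<open>- g - d\<close>.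
  The big algebra is a whole type; its subalgebras are sets.
\<close>

definition finitely_generated_group :: "'g::ab_group_add itself \<Rightarrow> bool" where
  "finitely_generated_group _ \<longleftrightarrow> (\<exists>X :: 'g set. finite X \<and> group_closure X = UNIV)"


subsection \<open>Algebras and gradings\<close>

locale k_algebra = vector_space scale
  for scale :: "'k::field \<Rightarrow> 'r::ring_1 \<Rightarrow> 'r" (infixr \<open>*s\<close> 75) +
  assumes scale_mult_left: "c *s (x * y) = (c *s x) * y"
    and scale_mult_right: "c *s (x * y) = x * (c *s y)"
begin

definition subalgebra :: "'r set \<Rightarrow> bool" where
  "subalgebra A \<longleftrightarrow> subspace A \<and> 1 \<in> A \<and> (\<forall>x\<in>A. \<forall>y\<in>A. x * y \<in> A)"

definition decomposition :: "'r set \<Rightarrow> ('g \<Rightarrow> 'r set) \<Rightarrow> bool" where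
  "decomposition A V \<longleftrightarrow>
     (\<forall>g. subspace (V g) \<and> V g \<subseteq> A) \<and>
     (\<forall>x\<in>A. \<exists>!f. (\<forall>g. f g \<in> V g) \<and> finite {g. f g \<noteq> 0} \<and> x = (\<Sum>g | f g \<noteq> 0. f g))"

definition k_finite :: "('g \<Rightarrow> 'r set) \<Rightarrow> bool" where
  "k_finite V \<longleftrightarrow> (\<forall>g. \<exists>X. finite X \<and> V g = span X)"

definition non_negative :: "('g::linordered_ab_group_add \<Rightarrow> 'r set) \<Rightarrow> bool" where
  "non_negative V \<longleftrightarrow> (\<forall>g<0. V g = {0})"

definition proper_grading :: "'r set \<Rightarrow> ('g::linordered_ab_group_add \<Rightarrow> 'r set) \<Rightarrow> bool" where
  "proper_grading A V \<longleftrightarrow> (\<forall>g. A \<noteq> span (\<Union>h\<in>{..g}. V h))"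

definition graded_algebra :: "'r set \<Rightarrow> ('g::linordered_ab_group_add \<Rightarrow> 'r set) \<Rightarrow> bool" where
  "graded_algebra A V \<longleftrightarrow>
     subalgebra A \<and> decomposition A V \<and>
     (\<forall>g h. \<forall>x\<in>V g. \<forall>y\<in>V h. x * y \<in> V (g + h)) \<and>
     k_finite V \<and> non_negative V \<and> proper_grading A V"

end

text \<open>The free left module \<open>A\<^sup>n\<close>, for a subring \<open>A\<close>, as functions supported on \<open>{..<n}\<close>.\<close>

definition free_left_module :: "'r::ring_1 set \<Rightarrow> nat \<Rightarrow> (nat \<Rightarrow> 'r) set" where
  "free_left_module A n = {v. (\<forall>i<n. v i \<in> A) \<and> (\<forall>i\<ge>n. v i = 0)}"

definition invariant_basis_number :: "'r::ring_1 set \<Rightarrow> bool" where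
  "invariant_basis_number A \<longleftrightarrow>
     (\<forall>m n. (\<exists>\<phi>. bij_betw \<phi> (free_left_module A m) (free_left_module A n) \<and>
        (\<forall>v\<in>free_left_module A m. \<forall>w\<in>free_left_module A m.
           \<phi> (\<lambda>i. v i + w i) = (\<lambda>i. \<phi> v i + \<phi> w i)) \<and>
        (\<forall>a\<in>A. \<forall>v\<in>free_left_module A m. \<phi> (\<lambda>i. a * v i) = (\<lambda>i. a * \<phi> v i)))
      \<longrightarrow> m = n)"


subsection \<open>The ring as a module over a subring\<close>

definition left_basis :: "'r::ring_1 set \<Rightarrow> 'r set \<Rightarrow> bool" where
  "left_basis S B \<longleftrightarrow>
     (\<forall>x. \<exists>!c. (\<forall>b\<in>B. c b \<in> S) \<and> (\<forall>b. b \<notin> B \<longrightarrow> c b = 0) \<and>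
               finite {b. c b \<noteq> 0} \<and> x = (\<Sum>b | c b \<noteq> 0. c b * b))"

definition homogeneous_left_basis :: "('g \<Rightarrow> 'r::ring_1 set) \<Rightarrow> 'r set \<Rightarrow> 'r set \<Rightarrow> bool" where
  "homogeneous_left_basis R S B \<longleftrightarrow> left_basis S B \<and> (\<forall>b\<in>B. \<exists>g. b \<in> R g)"

text \<open>The degree is only meaningful for non-zero homogeneous elements.\<close>

definition hdegree :: "('g \<Rightarrow> 'r set) \<Rightarrow> 'r \<Rightarrow> 'g" where
  "hdegree R x = (THE g. x \<in> R g)"

text \<open>
  If the ring is a non-zero finitely generated left module over \<open>S\<close>, all its bases over \<open>S\<close>
  are finite, so the convention of \<^const>\<open>mset_set\<close> for infinite sets plays no role.
\<close>

definition basis_degrees :: "('g \<Rightarrow> 'r set) \<Rightarrow> 'r set \<Rightarrow> 'g multiset" where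
  "basis_degrees R B = image_mset (hdegree R) (mset_set B)"


subsection \<open>Frobenius extensions\<close>

definition left_hom :: "'r::ring_1 set \<Rightarrow> ('r \<Rightarrow> 'r) set" where
  "left_hom S = {f. range f \<subseteq> S \<and> (\<forall>x y. f (x + y) = f x + f y) \<and> (\<forall>s\<in>S. \<forall>x. f (s * x) = s * f x)}"

text \<open>The bimodule structure on \<^term>\<open>left_hom S\<close> is \<open>(q.f)(r) = f(r q)\<close>, \<open>(f.s)(r) = f(r) s\<close>.\<close>

definition free_frobenius_extension :: "'r::ring_1 set \<Rightarrow> bool" where
  "free_frobenius_extension S \<longleftrightarrow>
     (\<exists>B. finite B \<and> left_basis S B) \<and>
     (\<exists>\<psi>. bij_betw \<psi> UNIV (left_hom S) \<and>
        (\<forall>x y. \<psi> (x + y) = (\<lambda>r. \<psi> x r + \<psi> y r)) \<and>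
        (\<forall>q x. \<psi> (q * x) = (\<lambda>r. \<psi> x (r * q))) \<and>
        (\<forall>x. \<forall>s\<in>S. \<psi> (x * s) = (\<lambda>r. \<psi> x r * s)))"

definition left_ideal :: "'r::ring_1 set \<Rightarrow> bool" where
  "left_ideal I \<longleftrightarrow> 0 \<in> I \<and> (\<forall>x\<in>I. \<forall>y\<in>I. x + y \<in> I) \<and> (\<forall>x\<in>I. \<forall>r. r * x \<in> I)"

definition right_ideal :: "'r::ring_1 set \<Rightarrow> bool" where
  "right_ideal I \<longleftrightarrow> 0 \<in> I \<and> (\<forall>x\<in>I. \<forall>y\<in>I. x + y \<in> I) \<and> (\<forall>x\<in>I. \<forall>r. x * r \<in> I)"

definition frobenius_form :: "'r::ring_1 set \<Rightarrow> ('r \<Rightarrow> 'r) \<Rightarrow> bool" where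
  "frobenius_form S \<Phi> \<longleftrightarrow>
     \<Phi> \<in> left_hom S \<and>
     (\<forall>I. (left_ideal I \<or> right_ideal I) \<and> I \<subseteq> {x. \<Phi> x = 0} \<longrightarrow> I = {0}) \<and>
     (\<lambda>r q. \<Phi> (q * r)) ` UNIV = left_hom S"

text \<open>A graded subalgebra \<open>S\<close> carries the grading \<open>S\<^sup>g = S \<inter> R\<^sup>g\<close>.\<close>

definition free_graded_frobenius_extension ::
  "('g::linordered_ab_group_add \<Rightarrow> 'r::ring_1 set) \<Rightarrow> 'r set \<Rightarrow> 'g \<Rightarrow> bool" where
  "free_graded_frobenius_extension R S d \<longleftrightarrow>
     free_frobenius_extension S \<and>
     (\<exists>\<Phi>. frobenius_form S \<Phi> \<and> (\<forall>g. \<Phi> ` R g \<subseteq> S \<inter> R (g + d))) \<and>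
     (\<exists>B. homogeneous_left_basis R S B)"

end

theory Submission
  imports Defs
begin

text \<open>
  The proof counts dimensions. Write \<open>s g = dim S\<^sup>g\<close>. Coordinates with respect to the
  homogeneous basis \<open>B\<close> split \<open>R\<^sup>h\<close> into the pieces of \<open>S\<close> of degrees \<open>h - deg b\<close>, so
  \<open>dim R\<^sup>h\<close> is the sum of \<open>s (h - deg b)\<close> over \<open>b \<in> B\<close>
  (\<open>dim_R_eq_sum_hilbert\<close>).

  The Frobenius form \<open>\<Phi>\<close> gives a second count. A left \<open>S\<close>-linear map on \<open>R\<close> is determined by
  its arbitrary values on \<open>B\<close>, and every such map is \<open>q \<mapsto> \<Phi> (q x)\<close> for exactly one \<open>x\<close>:
  existence is (F2), uniqueness is (F1). Hence \<open>x \<mapsto> (\<Phi> (b x))\<^sub>b\<close> is a bijection from \<open>R\<close> to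
  the families in \<open>S\<close> indexed by \<open>B\<close>. Because \<open>\<Phi>\<close> has degree \<open>d\<close>, it restricts to a
  \<open>k\<close>-linear bijection between \<open>R\<^sup>h\<close> and the families whose entry at \<open>b\<close> has degree
  \<open>h + deg b + d\<close>, and \<open>dim R\<^sup>h\<close> is also the sum of \<open>s (h + deg b + d)\<close>
  (\<open>dim_R_eq_sum_hilbert_dual\<close>).

  So the multiset \<open>D\<close> of degrees of \<open>B\<close> and the multiset \<open>-D - d\<close> have the same convolution with \<open>s\<close>. As \<open>s\<close> vanishes on
  negative elements and \<open>s 0 > 0\<close>, they agree
  (\<open>multiset_eq_if_convolution_eq\<close>): their least elements can be read off and cancelled.
\<close>

section \<open>Cancelling a non-negatively supported sequence\<close>

text \<open>
  At the least element \<open>m\<close> occurring in \<open>D\<close> or \<open>E\<close>, only the copies of \<open>m\<close> contribute to the two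
  sums, because \<open>s\<close> vanishes below \<open>0\<close>. So \<open>m\<close> occurs in both, and removing one copy from each
  keeps the sums equal.
\<close>

lemma multiset_eq_if_convolution_eq:
  fixes D E :: "'g::linordered_ab_group_add multiset" and s :: "'g \<Rightarrow> nat"
  assumes neg: "\<And>g. g < 0 \<Longrightarrow> s g = 0" and pos: "s 0 > 0"
    and eq: "\<And>h. (\<Sum>g\<in>#D. s (h - g)) = (\<Sum>g\<in>#E. s (h - g))"
  shows "D = E"
  using eq
proof (induction "size (D + E)" arbitrary: D E rule: less_induct)
  case less
  show ?case
  proof (cases "D + E = {#}")
    case True
    then show ?thesis by simp
  next
    case False
    define m where "m = Min_mset (D + E)"
    have m_in: "m \<in># D + E"
      unfolding m_def by (rule Min_in) (use False in auto)
    have m_le: "m \<le> g" if "g \<in># D + E" for g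
      unfolding m_def by (rule Min_le) (use that in auto)
    have least: "(\<Sum>g\<in>#F. s (m - g)) = count F m * s 0" if "F \<subseteq># D + E" for F
      using that
    proof (induction F)
      case empty
      then show ?case by simp
    next
      case (add x F)
      have "x \<in># D + E"
        using add.prems by (meson insert_subset_eq_iff)
      then have "s (m - x) = (if x = m then s 0 else 0)"
        using m_le[of x] by (auto intro!: neg)
      moreover have "F \<subseteq># D + E"
        using add.prems by (meson mset_subset_eq_insertD subset_mset.less_imp_le)
      ultimately show ?case
        using add.IH by auto
    qed
    have "count D m * s 0 = count E m * s 0"
      using less.prems[of m] by (simp add: least)
    then have "count D m = count E m"
      using pos by simp
    moreover have "count D m + count E m > 0"
      using m_in by (metis count_greater_zero_iff count_union)
    ultimately have "m \<in># D" "m \<in># E"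
      by (simp_all flip: count_greater_zero_iff)
    then obtain D' E' where D': "D = add_mset m D'" and E': "E = add_mset m E'"
      by (meson multi_member_split)
    have "D' = E'"
    proof (rule less.hyps)
      show "size (D' + E') < size (D + E)"
        by (simp add: D' E')
      show "(\<Sum>g\<in>#D'. s (h - g)) = (\<Sum>g\<in>#E'. s (h - g))" for h
        using less.prems[of h] by (simp add: D' E')
    qed
    then show ?thesis
      by (simp add: D' E')
  qed
qed


section \<open>The dimension of an internal product\<close>

context vector_space
begin

text \<open>
  The maps \<open>p i\<close> identify \<open>W\<close> with the product of the \<open>V i\<close>, so the bases of the \<open>V i\<close>, lifted to
  \<open>W\<close>, form a basis. The product is described by its projections because both
  identifications of a graded piece used below, by coordinates and by a Frobenius form, come
  as such; the inclusions of the factors are then obtained from bijectivity.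
\<close>

lemma dim_eq_sum_dim_projections:
  fixes I :: "'i set" and p :: "'i \<Rightarrow> 'b \<Rightarrow> 'b"
  assumes "finite I"
    and W: "subspace W"
    and V: "\<And>i. i \<in> I \<Longrightarrow> \<exists>X. finite X \<and> V i = span X"
    and add: "\<And>i x y. i \<in> I \<Longrightarrow> p i (x + y) = p i x + p i y"
    and scale: "\<And>i c x. i \<in> I \<Longrightarrow> p i (scale c x) = scale c (p i x)"
    and into: "\<And>i x. i \<in> I \<Longrightarrow> x \<in> W \<Longrightarrow> p i x \<in> V i"
    and iso: "\<And>c. \<forall>i\<in>I. c i \<in> V i \<Longrightarrow> \<exists>!x. x \<in> W \<and> (\<forall>i\<in>I. p i x = c i)"
  shows "dim W = (\<Sum>i\<in>I. dim (V i))"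
proof -
  have subV: "subspace (V i)" if "i \<in> I" for i
    using V[OF that] subspace_span by force
  have "\<exists>X. X \<subseteq> V i \<and> independent X \<and> V i \<subseteq> span X \<and> card X = dim (V i) \<and> finite X"
    if i: "i \<in> I" for i
  proof -
    obtain X where X: "X \<subseteq> V i" "independent X" "V i \<subseteq> span X" "card X = dim (V i)"
      by (rule basis_exists)
    moreover obtain Y where "finite Y" "V i = span Y"
      using V[OF i] by blast
    ultimately have "finite X"
      using independent_span_bound by blast
    with X show ?thesis by blast
  qed
  then obtain X where X: "\<And>i. i \<in> I \<Longrightarrow> X i \<subseteq> V i" "\<And>i. i \<in> I \<Longrightarrow> independent (X i)"
    "\<And>i. i \<in> I \<Longrightarrow> V i \<subseteq> span (X i)" "\<And>i. i \<in> I \<Longrightarrow> card (X i) = dim (V i)"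
    "\<And>i. i \<in> I \<Longrightarrow> finite (X i)"
    by metis
  have p0: "p i 0 = 0" if "i \<in> I" for i
    using add[OF that, of 0 0] by simp
  have p_sum: "p i (\<Sum>a\<in>A. f a) = (\<Sum>a\<in>A. p i (f a))" if "i \<in> I"
    for i and A :: "('i \<times> 'b) set" and f
    by (induction A rule: infinite_finite_induct) (simp_all add: p0 add that)
  \<comment> \<open>The inclusion of the factor \<open>V i\<close> into \<open>W\<close>.\<close>
  define e where "e i v = (THE x. x \<in> W \<and> (\<forall>j\<in>I. p j x = (if j = i then v else 0)))" for i v
  have e: "e i v \<in> W \<and> (\<forall>j\<in>I. p j (e i v) = (if j = i then v else 0))"
    if "i \<in> I" "v \<in> V i" for i v
    unfolding e_def
    by (rule theI', rule iso) (use that subV subspace_0 in auto)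
  define P where "P = Sigma I X"
  define f where "f = (\<lambda>(i, v). e i v)"
  have finP: "finite P"
    unfolding P_def using \<open>finite I\<close> X(5) by blast
  have fW: "f q \<in> W" if "q \<in> P" for q
    using that e X(1) unfolding P_def f_def by fastforce
  have p_comb: "p j (\<Sum>q\<in>P. scale (u q) (f q)) = (\<Sum>v\<in>X j. scale (u (j, v)) v)"
    if j: "j \<in> I" for u j
  proof -
    have "p j (\<Sum>q\<in>P. scale (u q) (f q)) = (\<Sum>q\<in>P. scale (u q) (p j (f q)))"
      by (subst p_sum[OF j], rule sum.cong) (rule refl, rule scale[OF j])
    also have "\<dots> = (\<Sum>i\<in>I. \<Sum>v\<in>X i. scale (u (i, v)) (p j (e i v)))"
      unfolding P_def f_def using \<open>finite I\<close> X(5) by (subst sum.Sigma) (auto intro!: sum.cong)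
    also have "\<dots> = (\<Sum>i\<in>I. if i = j then (\<Sum>v\<in>X j. scale (u (j, v)) v) else 0)"
    proof (rule sum.cong[OF refl])
      fix i assume i: "i \<in> I"
      have "p j (e i v) = (if j = i then v else 0)" if "v \<in> X i" for v
        using e[OF i] X(1)[OF i] that j by blast
      then show "(\<Sum>v\<in>X i. scale (u (i, v)) (p j (e i v)))
          = (if i = j then (\<Sum>v\<in>X j. scale (u (j, v)) v) else 0)"
        by (auto intro!: sum.neutral)
    qed
    also have "\<dots> = (\<Sum>v\<in>X j. scale (u (j, v)) v)"
      using \<open>finite I\<close> j by simp
    finally show ?thesis .
  qed
  have inj: "inj_on f P"
  proof (rule inj_onI)
    fix q r assume q: "q \<in> P" and r: "r \<in> P" and eq: "f q = f r"
    obtain i v j w where qr: "q = (i, v)" "r = (j, w)"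
      by fastforce
    have iv: "i \<in> I" "v \<in> X i" "v \<in> V i" and jw: "j \<in> I" "w \<in> X j" "w \<in> V j"
      using q r X(1) unfolding P_def qr by auto
    have "v \<noteq> 0"
      using X(2) iv dependent_zero by blast
    moreover have "p i (e i v) = v" "p i (e j w) = (if i = j then w else 0)"
      using e iv jw by auto
    ultimately show "q = r"
      using eq unfolding qr f_def by (auto split: if_splits)
  qed
  have indep: "independent (f ` P)"
  proof (rule independent_if_scalars_zero)
    show "finite (f ` P)"
      using finP by simp
    fix u x assume 0: "(\<Sum>x\<in>f ` P. scale (u x) x) = 0" and x: "x \<in> f ` P"
    obtain i v where iv: "i \<in> I" "v \<in> X i" "x = f (i, v)"
      using x unfolding P_def by auto
    have "(\<Sum>w\<in>X i. scale (u (f (i, w))) w) = p i (\<Sum>q\<in>P. scale (u (f q)) (f q))"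
      by (rule p_comb[symmetric]) fact
    also have "\<dots> = 0"
      using 0 p0 iv(1) by (simp add: sum.reindex[OF inj])
    finally have "(\<Sum>w\<in>X i. scale (u (f (i, w))) w) = 0" .
    then have "\<forall>w\<in>X i. u (f (i, w)) = 0"
      using X(2)[OF iv(1)] unfolding dependent_finite[OF X(5)[OF iv(1)]]
      by (auto dest: spec[where x = "\<lambda>w. u (f (i, w))"])
    then show "u x = 0"
      using iv by simp
  qed
  have spans: "W \<subseteq> span (f ` P)"
  proof
    fix x assume x: "x \<in> W"
    have "\<exists>a. p i x = (\<Sum>v\<in>X i. scale (a v) v)" if "i \<in> I" for i
      using into[OF that x] X(3)[OF that] span_finite[OF X(5)[OF that]] by auto
    then obtain a where a: "\<And>i. i \<in> I \<Longrightarrow> p i x = (\<Sum>v\<in>X i. scale (a i v) v)"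
      by metis
    define y where "y = (\<Sum>q\<in>P. scale (a (fst q) (snd q)) (f q))"
    have "y \<in> W"
      unfolding y_def using fW by (intro subspace_sum subspace_scale W)
    moreover have "p i y = p i x" if "i \<in> I" for i
      unfolding y_def by (simp add: p_comb[OF that] a[OF that])
    ultimately have "x = y"
      using iso[of "\<lambda>i. p i x"] x into by blast
    moreover have "y \<in> span (f ` P)"
      unfolding y_def by (intro span_sum span_scale span_base) auto
    ultimately show "x \<in> span (f ` P)" by simp
  qed
  have "dim W = card (f ` P)"
    using fW indep spans by (intro dim_unique) auto
  also have "\<dots> = card P"
    by (rule card_image[OF inj])
  also have "\<dots> = (\<Sum>i\<in>I. dim (V i))"
    unfolding P_def using \<open>finite I\<close> X(4,5) by simp
  finally show ?thesis .
qed

end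


section \<open>Homogeneous components\<close>

locale graded_k_algebra = k_algebra scale
  for scale :: "'k::field \<Rightarrow> 'r::ring_1 \<Rightarrow> 'r" (infixr \<open>*s\<close> 75) +
  fixes R :: "'g::linordered_ab_group_add \<Rightarrow> 'r set"
  assumes graded: "graded_algebra UNIV R"
begin

lemma subspace_R: "subspace (R g)"
  using graded unfolding graded_algebra_def decomposition_def by blast

lemma mult_R: "x \<in> R g \<Longrightarrow> y \<in> R h \<Longrightarrow> x * y \<in> R (g + h)"
  using graded unfolding graded_algebra_def by blast

lemma one_neq_zero: "(1::'r) \<noteq> 0"
proof
  assume "(1::'r) = 0"
  then have "x = 0" for x :: 'r
    by (metis mult_1 mult_zero_left)
  then have "(UNIV :: 'r set) = span (\<Union>h\<in>{..0}. R h)"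
    using span_zero by (metis UNIV_eq_I)
  then show False
    using graded unfolding graded_algebra_def proper_grading_def by blast
qed

definition component :: "'g \<Rightarrow> 'r \<Rightarrow> 'r" where
  "component g x =
     (THE f. (\<forall>g. f g \<in> R g) \<and> finite {g. f g \<noteq> 0} \<and> x = (\<Sum>g | f g \<noteq> 0. f g)) g"

lemma ex1_components:
  "\<exists>!f. (\<forall>g. f g \<in> R g) \<and> finite {g. f g \<noteq> 0} \<and> x = (\<Sum>g | f g \<noteq> 0. f g)"
  using graded unfolding graded_algebra_def decomposition_def by blast

lemma component_in_R: "component g x \<in> R g"
  and finite_support_component: "finite {g. component g x \<noteq> 0}"
  and sum_components: "(\<Sum>g | component g x \<noteq> 0. component g x) = x"
  using theI'[OF ex1_components[of x]] unfolding component_def by auto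

lemma component_eqI:
  assumes "\<And>g. f g \<in> R g" "finite G" "\<And>g. g \<notin> G \<Longrightarrow> f g = 0" "x = (\<Sum>g\<in>G. f g)"
  shows "component g x = f g"
proof -
  have "{g. f g \<noteq> 0} \<subseteq> G"
    using assms(3) by blast
  then have "finite {g. f g \<noteq> 0}" "x = (\<Sum>g | f g \<noteq> 0. f g)"
    using assms(2,4) by (auto intro: finite_subset sum.mono_neutral_right)
  then show ?thesis
    unfolding component_def using the1_equality[OF ex1_components, of f x] assms(1) by auto
qed

lemma component_homogeneous: "x \<in> R g \<Longrightarrow> component h x = (if h = g then x else 0)"
  by (rule component_eqI[where G = "{g}"]) (auto intro: subspace_0 subspace_R)

lemma component_add: "component g (x + y) = component g x + component g y"
proof (rule component_eqI)
  let ?G = "{g. component g x \<noteq> 0} \<union> {g. component g y \<noteq> 0}"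
  show "component h x + component h y \<in> R h" for h
    by (intro subspace_add subspace_R component_in_R)
  show "finite ?G"
    by (simp add: finite_support_component)
  show "component h x + component h y = 0" if "h \<notin> ?G" for h
    using that by simp
  have "x = (\<Sum>g\<in>?G. component g x)" "y = (\<Sum>g\<in>?G. component g y)"
    by (subst sum_components[symmetric], rule sum.mono_neutral_left;
        auto simp: finite_support_component)+
  then show "x + y = (\<Sum>g\<in>?G. component g x + component g y)"
    by (simp add: sum.distrib)
qed

lemma component_zero [simp]: "component g 0 = 0"
  using component_homogeneous[of 0 g g] subspace_0[OF subspace_R] by simp

lemma component_sum: "component g (\<Sum>a\<in>A. f a) = (\<Sum>a\<in>A. component g (f a))"
  by (induction A rule: infinite_finite_induct) (simp_all add: component_add)

text \<open>
  In this form the fact applies to multiplication by a homogeneous element on either side and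
  to \<open>x \<mapsto> \<Phi> (b x)\<close>.
\<close>

lemma component_homogeneous_map:
  fixes T :: "'r \<Rightarrow> 'r"
  assumes add: "\<And>x y. T (x + y) = T x + T y"
    and shift: "\<And>g x. x \<in> R g \<Longrightarrow> T x \<in> R (g + d)"
  shows "component (g + d) (T x) = T (component g x)"
proof -
  let ?G = "{h. component h x \<noteq> 0}"
  have T0: "T 0 = 0"
    using add[of 0 0] by simp
  have T_sum: "T (\<Sum>a\<in>A. f a) = (\<Sum>a\<in>A. T (f a))" for A :: "'g set" and f
    by (induction A rule: infinite_finite_induct) (simp_all add: T0 add)
  have "T x = (\<Sum>h\<in>?G. T (component h x))"
    by (metis T_sum sum_components)
  then have "component (g + d) (T x) = (\<Sum>h\<in>?G. component (g + d) (T (component h x)))"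
    by (simp add: component_sum)
  also have "\<dots> = (\<Sum>h\<in>?G. if h = g then T (component g x) else 0)"
    using component_homogeneous[OF shift[OF component_in_R]] by (intro sum.cong) auto
  also have "\<dots> = T (component g x)"
    using finite_support_component by (auto simp: T0)
  finally show ?thesis .
qed

text \<open>
  The degree-zero component \<open>e\<close> of \<open>1\<close> satisfies \<open>x e = x\<close> for every homogeneous \<open>x\<close>: compare
  the components of degree \<open>deg x\<close> in \<open>x = x 1\<close>. Summing this over the components of
  \<open>1\<close> gives \<open>e = 1\<close>.
\<close>

lemma one_in_R_zero: "1 \<in> R 0"
proof -
  have right_id: "x * component 0 1 = x" if x: "x \<in> R h" for x h
  proof -
    have "component (0 + h) (x * 1) = x * component 0 1"
    proof (rule component_homogeneous_map)
      show "x * (y + z) = x * y + x * z" for y z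
        by (simp add: distrib_left)
      show "x * y \<in> R (g + h)" if "y \<in> R g" for g y
        using mult_R[OF x that] by (simp add: add.commute)
    qed
    then show ?thesis
      using component_homogeneous[OF x] by simp
  qed
  have "component 0 1 = (\<Sum>g | component g 1 \<noteq> 0. component g 1) * component 0 1"
    by (simp add: sum_components)
  also have "\<dots> = (\<Sum>g | component g 1 \<noteq> 0. component g 1)"
    unfolding sum_distrib_right by (rule sum.cong) (auto intro: right_id component_in_R)
  also have "\<dots> = 1"
    by (rule sum_components)
  finally show ?thesis
    using component_in_R by metis
qed

lemma hdegree_eq:
  assumes "x \<in> R g" "x \<noteq> 0"
  shows "hdegree R x = g"
  unfolding hdegree_def
proof (rule the_equality)
  show "x \<in> R g" by fact
  fix h assume "x \<in> R h"
  then show "h = g"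
    using component_homogeneous[OF assms(1)] component_homogeneous assms(2) by metis
qed

end


section \<open>Graded subalgebras with a finite homogeneous basis\<close>

locale graded_free_extension = graded_k_algebra scale R
  for scale :: "'k::field \<Rightarrow> 'r::ring_1 \<Rightarrow> 'r" (infixr \<open>*s\<close> 75)
    and R :: "'g::linordered_ab_group_add \<Rightarrow> 'r set" +
  fixes S B :: "'r set"
  assumes graded_S: "graded_algebra S (\<lambda>g. S \<inter> R g)"
    and basis: "homogeneous_left_basis R S B"
    and finite_B: "finite B"
begin

abbreviation "deg \<equiv> hdegree R"

definition hilbert :: "'g \<Rightarrow> nat" where
  "hilbert g = dim (S \<inter> R g)"

lemma subspace_S: "subspace S"
  and one_in_S: "1 \<in> S"
  and mult_S: "x \<in> S \<Longrightarrow> y \<in> S \<Longrightarrow> x * y \<in> S"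
  using graded_S unfolding graded_algebra_def subalgebra_def by blast+

lemma scalar_in_S: "c *s 1 \<in> S"
  by (intro subspace_scale subspace_S one_in_S)

lemma S_finite: "\<exists>X. finite X \<and> S \<inter> R g = span X"
  using graded_S unfolding graded_algebra_def k_finite_def by blast

text \<open>
  The decomposition of \<open>x\<close> inside \<open>S\<close> is also a decomposition inside the big algebra, where
  decompositions are unique.
\<close>

lemma component_in_S:
  assumes "x \<in> S"
  shows "component g x \<in> S"
proof -
  obtain f where f: "\<And>g. f g \<in> S \<inter> R g" "finite {g. f g \<noteq> 0}" "x = (\<Sum>g | f g \<noteq> 0. f g)"
    using graded_S assms unfolding graded_algebra_def decomposition_def by blast
  have "component g x = f g"
    by (rule component_eqI[OF _ f(2) _ f(3)]) (use f(1) in auto)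
  then show ?thesis
    using f(1) by simp
qed

lemma hilbert_neg: "g < 0 \<Longrightarrow> hilbert g = 0"
  using graded_S unfolding graded_algebra_def non_negative_def hilbert_def
  by (metis dim_span dim_eq_card_independent card.empty independent_empty span_empty)

text \<open>
  The unit lies in degree zero. Finite dimensionality matters here: \<^const>\<open>dim\<close> is also \<open>0\<close> for
  spaces of infinite dimension.
\<close>

lemma hilbert_zero: "hilbert 0 > 0"
proof (rule ccontr)
  assume "\<not> hilbert 0 > 0"
  moreover obtain X where X: "X \<subseteq> S \<inter> R 0" "independent X" "S \<inter> R 0 \<subseteq> span X"
    "card X = hilbert 0"
    unfolding hilbert_def by (rule basis_exists)
  moreover obtain Y where "finite Y" "S \<inter> R 0 = span Y"
    using S_finite by blast
  ultimately have "X = {}"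
    using independent_span_bound[of Y X] by simp
  then show False
    using X(3) one_in_S one_in_R_zero one_neq_zero by auto
qed

definition coord :: "'r \<Rightarrow> 'r \<Rightarrow> 'r" where
  "coord x = (THE c. (\<forall>b\<in>B. c b \<in> S) \<and> (\<forall>b. b \<notin> B \<longrightarrow> c b = 0) \<and>
               finite {b. c b \<noteq> 0} \<and> x = (\<Sum>b | c b \<noteq> 0. c b * b))"

lemma ex1_coord:
  "\<exists>!c. (\<forall>b\<in>B. c b \<in> S) \<and> (\<forall>b. b \<notin> B \<longrightarrow> c b = 0) \<and>
     finite {b. c b \<noteq> 0} \<and> x = (\<Sum>b | c b \<noteq> 0. c b * b)"
  using basis unfolding homogeneous_left_basis_def left_basis_def by blast

lemma coord_in_S: "b \<in> B \<Longrightarrow> coord x b \<in> S"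
  and sum_coord: "(\<Sum>b\<in>B. coord x b * b) = x"
proof -
  let ?c = "coord x"
  have c: "\<forall>b\<in>B. ?c b \<in> S" "\<forall>b. b \<notin> B \<longrightarrow> ?c b = 0" "x = (\<Sum>b | ?c b \<noteq> 0. ?c b * b)"
    using theI'[OF ex1_coord[of x]] unfolding coord_def by auto
  show "b \<in> B \<Longrightarrow> ?c b \<in> S"
    using c(1) by blast
  have "(\<Sum>b | ?c b \<noteq> 0. ?c b * b) = (\<Sum>b\<in>B. ?c b * b)"
    by (rule sum.mono_neutral_left) (use c(2) finite_B in auto)
  with c(3) show "(\<Sum>b\<in>B. ?c b * b) = x"
    by simp
qed

lemma coord_eqI:
  assumes "\<And>b. b \<in> B \<Longrightarrow> c b \<in> S" "x = (\<Sum>b\<in>B. c b * b)" "b \<in> B"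
  shows "coord x b = c b"
proof -
  let ?c = "\<lambda>b. if b \<in> B then c b else 0"
  have "(\<Sum>b | ?c b \<noteq> 0. ?c b * b) = (\<Sum>b\<in>B. ?c b * b)"
    by (rule sum.mono_neutral_left) (use finite_B in auto)
  moreover have "\<dots> = x"
    unfolding assms(2) by (rule sum.cong) auto
  moreover have "finite {b. ?c b \<noteq> 0}"
    by (rule finite_subset[OF _ finite_B]) auto
  ultimately have "coord x = ?c"
    unfolding coord_def by (intro the1_equality[OF ex1_coord]) (use assms(1) in auto)
  then show ?thesis
    using assms(3) by simp
qed

lemma coord_add: "b \<in> B \<Longrightarrow> coord (x + y) b = coord x b + coord y b"
  by (rule coord_eqI)
    (auto simp: distrib_right sum.distrib sum_coord intro: subspace_add[OF subspace_S] coord_in_S)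

lemma coord_mult: "b \<in> B \<Longrightarrow> s \<in> S \<Longrightarrow> coord (s * x) b = s * coord x b"
  by (rule coord_eqI)
    (auto simp: mult.assoc sum_coord simp flip: sum_distrib_left intro: mult_S coord_in_S)

lemma coord_scale: "b \<in> B \<Longrightarrow> coord (c *s x) b = c *s coord x b"
  using coord_mult[of b "c *s 1" x] scalar_in_S by (simp flip: scale_mult_left)

lemma coord_basis:
  assumes "b \<in> B" "b' \<in> B"
  shows "coord b b' = (if b' = b then 1 else 0)"
proof (rule coord_eqI[OF _ _ assms(2)])
  show "(if b' = b then 1 else 0) \<in> S" for b'
    using one_in_S subspace_0[OF subspace_S] by simp
  show "b = (\<Sum>b'\<in>B. (if b' = b then 1 else 0) * b')"
    using assms(1) finite_B by (simp add: if_distrib[of "\<lambda>x. x * _"] cong: if_cong)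
qed

lemma basis_in_R:
  assumes "b \<in> B"
  shows "b \<in> R (deg b)"
proof -
  obtain g where g: "b \<in> R g"
    using basis assms unfolding homogeneous_left_basis_def by blast
  have "b \<noteq> 0"
  proof
    assume "b = 0"
    then have "coord b b = coord b b + coord b b"
      using coord_add[OF assms, of b b] by simp
    then have "coord b b = 0"
      by (metis add_cancel_right_right)
    then show False
      using coord_basis[OF assms assms] one_neq_zero by simp
  qed
  with g show ?thesis
    using hdegree_eq by simp
qed

text \<open>
  Replacing every coordinate of \<open>x\<close> by its component of degree \<open>h - deg b\<close> gives an expansion of the
  degree-\<open>h\<close> component of \<open>x\<close>, which is \<open>x\<close> itself; coordinates are unique.
\<close>

lemma coord_in_R:
  assumes x: "x \<in> R h" and b: "b \<in> B"
  shows "coord x b \<in> R (h - deg b)"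
proof -
  let ?c = "\<lambda>b. component (h - deg b) (coord x b)"
  have "component h (coord x b * b) = ?c b * b" if "b \<in> B" for b
  proof -
    have "component (h - deg b + deg b) (coord x b * b) = ?c b * b"
      using mult_R basis_in_R[OF that]
      by (intro component_homogeneous_map) (auto simp: distrib_right)
    then show ?thesis by simp
  qed
  then have "component h (\<Sum>b\<in>B. coord x b * b) = (\<Sum>b\<in>B. ?c b * b)"
    unfolding component_sum by (rule sum.cong[OF refl])
  then have "x = (\<Sum>b\<in>B. ?c b * b)"
    using component_homogeneous[OF x, of h] by (simp add: sum_coord)
  then have "coord x b = ?c b"
    by (intro coord_eqI b) (auto intro: component_in_S coord_in_S)
  then show ?thesis
    using component_in_R by metis
qed

lemma dim_R_eq_sum_hilbert: "dim (R h) = (\<Sum>b\<in>B. hilbert (h - deg b))"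
  unfolding hilbert_def
proof (rule dim_eq_sum_dim_projections[where p = "\<lambda>b x. coord x b"])
  fix c assume c: "\<forall>b\<in>B. c b \<in> S \<inter> R (h - deg b)"
  show "\<exists>!x. x \<in> R h \<and> (\<forall>b\<in>B. coord x b = c b)"
  proof (rule ex1I)
    have "c b * b \<in> R h" if "b \<in> B" for b
      using mult_R[of "c b" "h - deg b" b "deg b"] c basis_in_R that by simp
    then have "(\<Sum>b\<in>B. c b * b) \<in> R h"
      by (rule subspace_sum[OF subspace_R])
    moreover have "coord (\<Sum>b\<in>B. c b * b) b = c b" if "b \<in> B" for b
      using c that by (intro coord_eqI) auto
    ultimately show "(\<Sum>b\<in>B. c b * b) \<in> R h \<and> (\<forall>b\<in>B. coord (\<Sum>b\<in>B. c b * b) b = c b)"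
      by blast
  next
    fix x assume "x \<in> R h \<and> (\<forall>b\<in>B. coord x b = c b)"
    then show "x = (\<Sum>b\<in>B. c b * b)"
      using sum_coord[of x] by simp
  qed
qed (auto simp: finite_B subspace_R S_finite coord_add coord_scale coord_in_S coord_in_R)


section \<open>Counting dimensions through the Frobenius form\<close>

context
  fixes \<Phi> :: "'r \<Rightarrow> 'r" and d :: 'g
  assumes form: "frobenius_form S \<Phi>"
    and form_degree: "\<And>g. \<Phi> ` R g \<subseteq> S \<inter> R (g + d)"
begin

lemma form_in_S: "\<Phi> x \<in> S"
  and form_add: "\<Phi> (x + y) = \<Phi> x + \<Phi> y"
  and form_mult: "s \<in> S \<Longrightarrow> \<Phi> (s * x) = s * \<Phi> x"
  using form unfolding frobenius_form_def left_hom_def by auto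

lemma form_scale: "\<Phi> (c *s x) = c *s \<Phi> x"
  using form_mult[OF scalar_in_S, of c x] by (simp flip: scale_mult_left)

lemma form_sum: "\<Phi> (\<Sum>a\<in>A. f a) = (\<Sum>a\<in>A. \<Phi> (f a))"
proof -
  have "\<Phi> 0 = 0"
    using form_add[of 0 0] by simp
  then show ?thesis
    by (induction A rule: infinite_finite_induct) (simp_all add: form_add)
qed

text \<open>
  By left linearity, \<open>\<Phi>\<close> vanishes on the whole left ideal generated by \<open>x\<close>, which is
  therefore zero by (F1).
\<close>

lemma form_nondegenerate:
  assumes "\<And>b. b \<in> B \<Longrightarrow> \<Phi> (b * x) = 0"
  shows "x = 0"
proof -
  have "\<Phi> (q * x) = 0" for q
  proof -
    have "\<Phi> ((\<Sum>b\<in>B. coord q b * b) * x) = 0"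
      by (simp add: sum_distrib_right form_sum mult.assoc form_mult coord_in_S assms)
    then show ?thesis
      by (simp add: sum_coord)
  qed
  then have "range (\<lambda>q. q * x) \<subseteq> {x. \<Phi> x = 0}"
    by auto
  moreover have "left_ideal (range (\<lambda>q. q * x))"
    unfolding left_ideal_def
    by (auto simp: image_iff simp flip: distrib_right mult.assoc) (metis mult_zero_left)
  ultimately have "range (\<lambda>q. q * x) = {0}"
    using form unfolding frobenius_form_def by blast
  then have "1 * x = 0"
    by blast
  then show ?thesis by simp
qed

lemma component_form_mult:
  assumes "b \<in> B"
  shows "component (h + (deg b + d)) (\<Phi> (b * x)) = \<Phi> (b * component h x)"
proof (rule component_homogeneous_map[where T = "\<lambda>x. \<Phi> (b * x)"])
  show "\<Phi> (b * (x + y)) = \<Phi> (b * x) + \<Phi> (b * y)" for x y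
    by (simp add: distrib_left form_add)
  show "\<Phi> (b * x) \<in> R (g + (deg b + d))" if "x \<in> R g" for g x
    using mult_R[OF basis_in_R[OF assms] that] form_degree[of "deg b + g"]
    by (auto simp: ac_simps)
qed

text \<open>
  The map taking \<open>q\<close> to the sum of \<open>coord q b * c b\<close> is left \<open>S\<close>-linear with value \<open>c b\<close> at \<open>b\<close>, and
  (F2) represents it as \<open>q \<mapsto> \<Phi> (q x)\<close>.
\<close>

lemma ex_form_eq:
  assumes "\<And>b. b \<in> B \<Longrightarrow> c b \<in> S"
  shows "\<exists>x. \<forall>b\<in>B. \<Phi> (b * x) = c b"
proof -
  let ?f = "\<lambda>q. \<Sum>b\<in>B. coord q b * c b"
  have "?f \<in> left_hom S"
    unfolding left_hom_def
    using assms subspace_S mult_S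
    by (auto simp: coord_add coord_mult distrib_right sum.distrib sum_distrib_left mult.assoc
        intro!: subspace_sum coord_in_S)
  then have "?f \<in> range (\<lambda>r q. \<Phi> (q * r))"
    using form unfolding frobenius_form_def by blast
  then obtain x where "?f = (\<lambda>q. \<Phi> (q * x))"
    by (rule rangeE)
  then have x: "\<Phi> (q * x) = ?f q" for q
    by (rule fun_cong[symmetric])
  have "?f b = c b" if "b \<in> B" for b
  proof -
    have "?f b = (\<Sum>b'\<in>B. if b' = b then c b else 0)"
      using that by (intro sum.cong) (auto simp: coord_basis)
    then show ?thesis
      using that finite_B by simp
  qed
  then have "\<Phi> (b * x) = c b" if "b \<in> B" for b
    using x[of b] that by simp
  then show ?thesis by blast
qed

text \<open>
  The solution \<open>x\<close> of \<open>\<Phi> (b x) = c b\<close> may be inhomogeneous a priori, but if every \<open>c b\<close> has degree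
  \<open>h + deg b + d\<close>, the degree-\<open>h\<close> component of \<open>x\<close> solves the same equations.
\<close>

lemma dim_R_eq_sum_hilbert_dual: "dim (R h) = (\<Sum>b\<in>B. hilbert (h + (deg b + d)))"
  unfolding hilbert_def
proof (rule dim_eq_sum_dim_projections[where p = "\<lambda>b x. \<Phi> (b * x)"])
  fix c assume c: "\<forall>b\<in>B. c b \<in> S \<inter> R (h + (deg b + d))"
  then obtain x where x: "\<And>b. b \<in> B \<Longrightarrow> \<Phi> (b * x) = c b"
    using ex_form_eq[of c] by auto
  show "\<exists>!x. x \<in> R h \<and> (\<forall>b\<in>B. \<Phi> (b * x) = c b)"
  proof (rule ex1I)
    have "\<Phi> (b * component h x) = c b" if "b \<in> B" for b
      using component_form_mult[OF that, of h x] x[OF that] that c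
      by (simp add: component_homogeneous[where g = "h + (deg b + d)"])
    then show "component h x \<in> R h \<and> (\<forall>b\<in>B. \<Phi> (b * component h x) = c b)"
      using component_in_R by blast
    fix y assume y: "y \<in> R h \<and> (\<forall>b\<in>B. \<Phi> (b * y) = c b)"
    have "y - component h x = 0"
    proof (rule form_nondegenerate)
      fix b assume "b \<in> B"
      then have "\<Phi> (b * (y - component h x) + b * component h x) = \<Phi> (b * component h x)"
        using y \<open>\<And>b. b \<in> B \<Longrightarrow> \<Phi> (b * component h x) = c b\<close>
        by (simp add: right_diff_distrib)
      then show "\<Phi> (b * (y - component h x)) = 0"
        unfolding form_add by simp
    qed
    then show "y = component h x" by simp
  qed
next
  fix b x assume b: "b \<in> B" and x: "x \<in> R h"
  have "b * x \<in> R (deg b + h)"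
    using mult_R basis_in_R b x by blast
  then show "\<Phi> (b * x) \<in> S \<inter> R (h + (deg b + d))"
    using form_degree[of "deg b + h"] by (auto simp: ac_simps)
qed (auto simp: finite_B subspace_R S_finite distrib_left form_add form_scale
    simp flip: scale_mult_right)

lemma basis_degrees_symmetric:
  "basis_degrees R B = image_mset (\<lambda>g. - g - d) (basis_degrees R B)"
proof (rule multiset_eq_if_convolution_eq[where s = hilbert])
  fix h
  have "(\<Sum>g\<in>#basis_degrees R B. hilbert (h - g)) = (\<Sum>b\<in>B. hilbert (h - deg b))"
    by (simp add: basis_degrees_def multiset.map_comp o_def sum_unfold_sum_mset)
  also have "\<dots> = (\<Sum>b\<in>B. hilbert (h - (- deg b - d)))"
    using dim_R_eq_sum_hilbert[of h] dim_R_eq_sum_hilbert_dual[of h] by (simp add: algebra_simps)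
  also have "\<dots> = (\<Sum>g\<in>#image_mset (\<lambda>g. - g - d) (basis_degrees R B). hilbert (h - g))"
    by (simp add: basis_degrees_def multiset.map_comp o_def sum_unfold_sum_mset)
  finally show "(\<Sum>g\<in>#basis_degrees R B. hilbert (h - g))
      = (\<Sum>g\<in>#image_mset (\<lambda>g. - g - d) (basis_degrees R B). hilbert (h - g))" .
qed (simp_all add: hilbert_neg hilbert_zero)

end

end


section \<open>The degrees of a homogeneous basis\<close>

theorem lemma5p5:
  fixes scale :: "'k::field \<Rightarrow> 'r::ring_1 \<Rightarrow> 'r"
    and R :: "'g::linordered_ab_group_add \<Rightarrow> 'r set"
    and S B :: "'r set"
    and d :: 'g
  assumes "finitely_generated_group TYPE('g)"
    and "k_algebra scale"
    and "k_algebra.graded_algebra scale UNIV R"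
    and "invariant_basis_number (UNIV :: 'r set)"
    and "k_algebra.graded_algebra scale S (\<lambda>g. S \<inter> R g)"
    and "invariant_basis_number S"
    and "free_graded_frobenius_extension R S d"
    and "homogeneous_left_basis R S B"
  shows "basis_degrees R B = image_mset (\<lambda>g. - g - d) (basis_degrees R B)"
proof (cases "finite B")
  case True
  interpret k_algebra scale by fact
  interpret graded_free_extension scale R S B
    by unfold_locales (fact assms True)+
  obtain \<Phi> where "frobenius_form S \<Phi>" "\<And>g. \<Phi> ` R g \<subseteq> S \<inter> R (g + d)"
    using assms(7) unfolding free_graded_frobenius_extension_def by blast
  then show ?thesis
    by (rule basis_degrees_symmetric)
next
  \<comment> \<open>By convention, \<^const>\<open>mset_set\<close> of an infinite set is the empty multiset.\<close>
  case False
  then show ?thesis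
    by (simp add: basis_degrees_def)
qed

end
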